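(* Let $p$ be a prime and let $d$ be an integer with $d\mid p-1$ and $1<d<p-1$. Let $\mu_d=\{x\in\mathbb F_p: x^d=1\}$ be the set of $d$-th roots of unity in $\mathbb F_p$. If there is a set $A\subset\mathbb F_p$ with $A-A=\mu_d\cup\{0\}$, where $A-A=\{a_1-a_2: a_1,a_2\in A\}$, then $d=2$ or $d=6$. *)

theory Defs
  imports "Berlekamp_Zassenhaus.Finite_Field"
begin

text \<open>
  The field with \<open>p\<close> elements is the type \<^typ>\<open>'p mod_ring\<close> of residues modulo
  \<open>p = CARD('p)\<close>; the sort constraint \<^class>\<open>prime_card\<close> says that \<open>p\<close> is prime.
\<close>

definition unity_roots :: "nat \<Rightarrow> 'p::prime_card mod_ring set" where
  "unity_roots d = {x. x ^ d = 1}"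

definition difference_set :: "'p::prime_card mod_ring set \<Rightarrow> 'p mod_ring set" where
  "difference_set A = {a1 - a2 | a1 a2. a1 \<in> A \<and> a2 \<in> A}"

end

theory Submission
  imports Defs "HOL-Computational_Algebra.Polynomial_FPS"
begin

text \<open>
  Let \<open>n = |A|\<close>, \<open>f = \<Prod>(x - a)\<close> over \<open>a \<in> A\<close> and \<open>c\<^sub>a = 1 / f'(a)\<close>. Stepanov's method in
  the form of Hanson and Petridis considers
  \<open>F = \<Sum> c\<^sub>a (a - x)\<^bsup>d + n - 1\<^esup> - 1\<close>. The weights cancel the top coefficients, so
  \<open>deg F \<le> d\<close>, and since all nonzero differences are \<open>d\<close>-th roots of unity, \<open>F\<close> vanishes
  to order \<open>n - 1\<close> on \<open>A\<close>. Hence \<open>n (n - 1) \<le> d\<close>; as the differences cover \<open>\<mu>\<^sub>d\<close>, equality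
  holds, every nonzero difference occurs once, and \<open>F\<close> is a multiple of \<open>f\<^bsup>n - 1\<^esup>\<close>.

  Comparing the Taylor coefficients of \<open>F\<close> and \<open>f\<^bsup>n - 1\<^esup>\<close> at a root of \<open>f\<close> two and three
  steps beyond the first nonzero one gives two relations between the first four derivatives of
  \<open>f\<close> at that root. For \<open>n \<ge> 4\<close> they say that the differential polynomial
  \<open>L = n (n + 1) f f\<^sub>4 - 4 n (n - 2) f\<^sub>1 f\<^sub>3 + 3 (n - 1) (n - 2) f\<^sub>2\<^sup>2\<close>, where \<open>f\<^sub>k\<close> is the \<open>k\<close>-th derivative,
  vanishes doubly on \<open>A\<close>; its degree is less than \<open>2 n\<close>, so \<open>L = 0\<close>.

  Translate so that \<open>A\<close> has sum \<open>0\<close>, and let \<open>x\<^sup>j\<close> be the second highest monomial of \<open>f\<close>.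
  The leading terms of \<open>L = 0\<close> give \<open>(n + 1) j = (n - 2) (n - 3)\<close>, so \<open>n + 1\<close> divides \<open>12\<close>
  and \<open>n\<close> is \<open>5\<close> or \<open>11\<close>. For \<open>n = 5\<close> one finds \<open>A = - A\<close> and \<open>0 \<in> A\<close>, which produces a
  repeated difference; for \<open>n = 11\<close> the fifth Taylor coefficient at \<open>0\<close> gives a contradiction.
\<close>

section \<open>Lagrange weights and the Stepanov polynomial\<close>

definition vanishing_poly :: "'a::field set \<Rightarrow> 'a poly" where
  "vanishing_poly B = (\<Prod>b\<in>B. [:- b, 1:])"

definition lagrange_weight :: "'a::field set \<Rightarrow> 'a \<Rightarrow> 'a" where
  "lagrange_weight B b = inverse (\<Prod>x\<in>B - {b}. b - x)"

definition stepanov_poly :: "'a::field set \<Rightarrow> nat \<Rightarrow> 'a poly" where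
  "stepanov_poly B N = (\<Sum>b\<in>B. smult (lagrange_weight B b) ([:b, - 1:] ^ N)) - 1"

lemma degree_vanishing_poly: "degree (vanishing_poly B) = card B"
  unfolding vanishing_poly_def by (subst degree_prod_eq_sum_degree) auto

lemma lead_coeff_vanishing_poly: "lead_coeff (vanishing_poly B) = 1"
  unfolding vanishing_poly_def by (simp add: lead_coeff_prod)

lemma poly_vanishing_poly_eq_0_iff:
  "finite B \<Longrightarrow> poly (vanishing_poly B) x = 0 \<longleftrightarrow> x \<in> B"
  unfolding vanishing_poly_def by (auto simp: poly_prod)

lemma vanishing_poly_nonzero: "vanishing_poly B \<noteq> 0"
  using lead_coeff_vanishing_poly[of B] by auto

lemma vanishing_poly_remove:
  "finite B \<Longrightarrow> b \<in> B \<Longrightarrow> vanishing_poly B = [:- b, 1:] * vanishing_poly (B - {b})"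
  unfolding vanishing_poly_def by (rule prod.remove)

lemma lagrange_weight_nonzero: "finite B \<Longrightarrow> lagrange_weight B b \<noteq> 0"
  unfolding lagrange_weight_def by auto

text \<open>Both sides have degree below \<open>card B\<close> and agree on \<open>B\<close>: each
  basis polynomial vanishes on \<open>B\<close> except at its own point.\<close>

lemma lagrange_interpolation:
  assumes "finite B" and "degree q < card B"
  shows "q = (\<Sum>b\<in>B. smult (lagrange_weight B b * poly q b) (vanishing_poly (B - {b})))"
    (is "q = ?r")
proof -
  have root: "poly q x = poly ?r x" if x: "x \<in> B" for x
  proof -
    have "poly ?r x = (\<Sum>b\<in>B. lagrange_weight B b * poly q b * poly (vanishing_poly (B - {b})) x)"
      by (simp add: poly_sum)
    also have "\<dots> = (\<Sum>b\<in>B. if b = x then poly q x else 0)"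
    proof (rule sum.cong)
      fix b assume b: "b \<in> B"
      show "lagrange_weight B b * poly q b * poly (vanishing_poly (B - {b})) x =
          (if b = x then poly q x else 0)"
      proof (cases "b = x")
        case True
        have "(\<Prod>y\<in>B - {x}. x - y) \<noteq> 0" using assms(1) by simp
        moreover have "poly (vanishing_poly (B - {x})) x = (\<Prod>y\<in>B - {x}. x - y)"
          unfolding vanishing_poly_def by (simp add: poly_prod)
        ultimately show ?thesis using True by (simp add: lagrange_weight_def)
      next
        case False
        then have "poly (vanishing_poly (B - {b})) x = 0"
          using x assms(1) by (subst poly_vanishing_poly_eq_0_iff) auto
        with False show ?thesis by simp
      qed
    qed simp
    also have "\<dots> = poly q x" using x assms(1) by simp
    finally show ?thesis by simp
  qed
  have deg: "degree ?r \<le> card B - 1"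
  proof (rule degree_sum_le[OF assms(1)])
    fix b assume "b \<in> B"
    then have "degree (vanishing_poly (B - {b})) = card B - 1"
      using assms(1) by (simp add: degree_vanishing_poly)
    then show "degree (smult (lagrange_weight B b * poly q b) (vanishing_poly (B - {b}))) \<le> card B - 1"
      using degree_smult_le by metis
  qed
  show ?thesis
    by (rule poly_eqI_degree[of B]) (use root deg assms(2) in auto)
qed

text \<open>Every basis polynomial of the interpolation formula is monic of degree
  \<open>card B - 1\<close>; compare coefficients there.\<close>

lemma sum_lagrange_weight:
  assumes "finite B" and "degree q < card B"
  shows "(\<Sum>b\<in>B. lagrange_weight B b * poly q b) = coeff q (card B - 1)"
proof -
  have lead: "coeff (vanishing_poly (B - {b})) (card B - 1) = 1" if "b \<in> B" for b
    using lead_coeff_vanishing_poly[of "B - {b}"] that assms(1)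
    by (simp add: degree_vanishing_poly)
  show ?thesis
    by (subst (2) lagrange_interpolation[OF assms]) (simp add: coeff_sum lead del: One_nat_def)
qed

lemma sum_lagrange_weight_power:
  assumes "finite B" and "m < card B"
  shows "(\<Sum>b\<in>B. lagrange_weight B b * b ^ m) = (if m = card B - 1 then 1 else 0)"
  using sum_lagrange_weight[of B "monom 1 m"] assms
  by (simp add: degree_monom_eq poly_monom)

lemma coeff_stepanov_poly:
  assumes "m \<le> N"
  shows "coeff (stepanov_poly B N) m =
    (- 1) ^ m * of_nat (N choose m) * (\<Sum>b\<in>B. lagrange_weight B b * b ^ (N - m)) -
    (if m = 0 then 1 else 0)"
proof -
  have "coeff ([:b, - 1:] ^ N) m = (- 1) ^ m * of_nat (N choose m) * b ^ (N - m)" for b :: 'a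
    using assms by (simp add: coeff_linear_poly_power)
  then show ?thesis
    unfolding stepanov_poly_def
    by (simp add: coeff_sum sum_distrib_left algebra_simps)
qed

text \<open>The coefficient of \<open>x^m\<close> is a multiple of a moment of order
  \<open>N - m\<close>, and \<open>m > d\<close> puts this order below \<open>card B - 1\<close>,
  where moments vanish.\<close>

lemma degree_stepanov_poly:
  assumes "finite B" and "B \<noteq> {}"
  shows "degree (stepanov_poly B (d + (card B - 1))) \<le> d"
proof (rule degree_le, intro allI impI)
  fix m assume m: "d < m"
  let ?N = "d + (card B - 1)"
  have card: "card B > 0" using assms by (simp add: card_gt_0_iff)
  show "coeff (stepanov_poly B ?N) m = 0"
  proof (cases "m \<le> ?N")
    case True
    have "?N - m < card B" "?N - m \<noteq> card B - 1" using m True card by linarith+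
    then show ?thesis
      using True m assms(1) by (simp add: coeff_stepanov_poly sum_lagrange_weight_power)
  next
    case False
    have "coeff ([:b, - 1:] ^ ?N) m = 0" for b :: 'a
    proof (rule coeff_eq_0)
      have "degree ([:b, - 1:] ^ ?N) \<le> degree [:b, - 1:] * ?N" by (rule degree_power_le)
      then show "degree ([:b, - 1:] ^ ?N) < m" using False by simp
    qed
    then show ?thesis using False by (simp add: stepanov_poly_def coeff_sum)
  qed
qed

section \<open>Negative moments and their generating series\<close>

text \<open>For \<open>d\<close>-th roots of unity \<open>b^(d-k)\<close> is
  \<open>inverse b ^ k\<close>, so these sums govern the Stepanov coefficients from order
  \<open>card B - 1\<close> on. The point \<open>0\<close> is left out because it would still
  contribute for \<open>k = 0\<close>.\<close>

definition negative_moment :: "'a::field set \<Rightarrow> nat \<Rightarrow> 'a" where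
  "negative_moment B k = (\<Sum>b\<in>B - {0}. lagrange_weight B b * inverse b ^ k)"

lemma negative_moment_0:
  assumes "finite B" and "0 \<in> B" and "card B \<ge> 2"
  shows "negative_moment B 0 = - lagrange_weight B 0"
proof -
  have "(\<Sum>b\<in>B. lagrange_weight B b) = 0"
    using sum_lagrange_weight_power[of B 0] assms by simp
  then show ?thesis
    using sum.remove[OF assms(1,2), of "lagrange_weight B"]
    by (simp add: negative_moment_def eq_neg_iff_add_eq_0 add.commute)
qed

text \<open>Write \<open>f = x G\<close>. Partial fractions give \<open>1 / f\<close> as the sum of
  \<open>c_b / (x - b)\<close>; multiplying by \<open>x\<close> and expanding at \<open>0\<close>
  shows that \<open>1 / G\<close> is minus the series of negative moments.\<close>

lemma negative_moment_series:
  assumes "finite B" and "0 \<in> B" and "card B \<ge> 2"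
  shows "fps_of_poly (vanishing_poly (B - {0})) * Abs_fps (negative_moment B) = - 1"
proof -
  define G where "G = fps_of_poly (vanishing_poly (B - {0}))"
  define E where "E = (\<lambda>b::'a. Abs_fps (\<lambda>k. inverse b ^ Suc k))"
  define W where "W = (\<lambda>b. fps_const (lagrange_weight B b))"
  \<comment> \<open>\<open>E b\<close> is the expansion of \<open>1 / (b - x)\<close> at
    \<open>0\<close>.\<close>
  have E: "(fps_X - fps_const b) * E b = - 1" if "b \<noteq> 0" for b
  proof (rule fps_ext)
    fix k show "fps_nth ((fps_X - fps_const b) * E b) k = fps_nth (- 1) k"
      using that by (cases k) (simp_all add: E_def left_diff_distrib field_simps)
  qed
  have P: "fps_of_poly (vanishing_poly (B - {b})) = - (fps_X * G * E b)" if b: "b \<in> B - {0}" for b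
  proof -
    let ?P = "fps_of_poly (vanishing_poly (B - {b}))"
    have "[:- b, 1:] * vanishing_poly (B - {b}) = [:0, 1:] * vanishing_poly (B - {0})"
      using vanishing_poly_remove[OF assms(1), of b] vanishing_poly_remove[OF assms(1,2)] b
      by simp
    then have "fps_of_poly ([:- b, 1:] * vanishing_poly (B - {b})) =
        fps_of_poly ([:0, 1:] * vanishing_poly (B - {0}))" by (rule arg_cong)
    then have "(fps_X - fps_const b) * ?P = fps_X * G"
      unfolding fps_of_poly_mult G_def by (simp add: fps_of_poly_linear)
    then have "((fps_X - fps_const b) * E b) * ?P = fps_X * G * E b"
      by (simp only: mult_ac)
    moreover have "(fps_X - fps_const b) * E b = - 1" using E b by simp
    ultimately have "- ?P = fps_X * G * E b" by simp
    then show ?thesis by (metis minus_minus)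
  qed
  have "1 = (\<Sum>b\<in>B. smult (lagrange_weight B b) (vanishing_poly (B - {b})))"
    using lagrange_interpolation[of B 1] assms by simp
  then have "fps_of_poly 1 =
      fps_of_poly (\<Sum>b\<in>B. smult (lagrange_weight B b) (vanishing_poly (B - {b})))"
    by (rule arg_cong)
  then have "1 = (\<Sum>b\<in>B. W b * fps_of_poly (vanishing_poly (B - {b})))"
    by (simp add: fps_of_poly_sum fps_of_poly_smult W_def)
  also have "\<dots> = W 0 * G + (\<Sum>b\<in>B - {0}. W b * fps_of_poly (vanishing_poly (B - {b})))"
    using assms by (simp add: sum.remove G_def)
  also have "\<dots> = W 0 * G + (\<Sum>b\<in>B - {0}. W b * - (fps_X * G * E b))"
    using P by simp
  also have "\<dots> = - (G * (- W 0 + fps_X * (\<Sum>b\<in>B - {0}. W b * E b)))"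
    by (simp add: algebra_simps sum_distrib_left sum_negf)
  also have "- W 0 + fps_X * (\<Sum>b\<in>B - {0}. W b * E b) = Abs_fps (negative_moment B)"
  proof (rule fps_ext)
    fix k
    show "fps_nth (- W 0 + fps_X * (\<Sum>b\<in>B - {0}. W b * E b)) k =
        fps_nth (Abs_fps (negative_moment B)) k"
    proof (cases k)
      case 0
      then show ?thesis using negative_moment_0[OF assms] by (simp add: W_def)
    next
      case (Suc l)
      then show ?thesis
        by (simp add: W_def E_def negative_moment_def fps_sum_nth)
    qed
  qed
  finally have "- (G * Abs_fps (negative_moment B)) = 1" by (rule sym)
  then have "- (- (G * Abs_fps (negative_moment B))) = - 1" by (rule arg_cong)
  then show ?thesis unfolding G_def minus_minus .
qed

section \<open>Vanishing order and the bound on the cardinality\<close>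

lemma of_nat_nonzero_less_CHAR:
  "0 < k \<Longrightarrow> k < CHAR('a::semiring_1) \<Longrightarrow> (of_nat k :: 'a) \<noteq> 0"
  by (simp add: of_nat_eq_0_iff_char_dvd nat_dvd_not_less)

lemma numeral_nonzero_less_CHAR:
  "numeral k < CHAR('a::semiring_1) \<Longrightarrow> (numeral k :: 'a) \<noteq> 0"
  using of_nat_nonzero_less_CHAR[OF zero_less_numeral, of k, where ?'a = 'a] by simp

lemma of_nat_binomial_nonzero:
  assumes "N < CHAR('a::field)" and "k \<le> N"
  shows "(of_nat (N choose k) :: 'a) \<noteq> 0"
proof
  assume "(of_nat (N choose k) :: 'a) = 0"
  then have "CHAR('a) dvd fact N"
    by (metis assms(2) binomial_fact_lemma dvd_mult of_nat_eq_0_iff_char_dvd)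
  moreover have "prime CHAR('a)"
    using assms(1) by (intro prime_CHAR_semidom) simp
  ultimately show False
    using assms(1) by (simp add: prime_dvd_fact_iff)
qed

text \<open>As \<open>b^d = 1\<close>, the moment of order \<open>N - m\<close> equals the one of
  order \<open>card B - 1 - m\<close>. It is \<open>0\<close> for \<open>m > 0\<close>; for
  \<open>m = 0\<close> it is \<open>1\<close> and cancels the constant \<open>- 1\<close>.\<close>

lemma coeff_stepanov_poly_low:
  assumes "finite B" and "card B \<ge> 2" and "0 < d"
    and roots: "\<And>b. b \<in> B \<Longrightarrow> b \<noteq> 0 \<Longrightarrow> b ^ d = 1"
    and m: "m < card B - 1"
  shows "coeff (stepanov_poly B (d + (card B - 1))) m = 0"
proof -
  let ?N = "d + (card B - 1)"
  have "b ^ (?N - m) = b ^ (card B - 1 - m)" if "b \<in> B" for b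
  proof (cases "b = 0")
    case False
    have "?N - m = d + (card B - 1 - m)" using m by simp
    then show ?thesis using roots[OF that False] by (simp add: power_add)
  qed (use m assms(3) in \<open>simp add: power_0_left\<close>)
  then have "(\<Sum>b\<in>B. lagrange_weight B b * b ^ (?N - m)) = (if m = 0 then 1 else 0)"
    using sum_lagrange_weight_power[of B "card B - 1 - m"] assms(1,2) m by auto
  then show ?thesis using m by (simp add: coeff_stepanov_poly)
qed

lemma coeff_stepanov_poly_high:
  assumes "finite B" and "0 \<in> B" and "card B \<ge> 2"
    and roots: "\<And>b. b \<in> B \<Longrightarrow> b \<noteq> 0 \<Longrightarrow> b ^ d = 1"
    and k: "k < d"
  shows "coeff (stepanov_poly B (d + (card B - 1))) (card B - 1 + k) =
    (- 1) ^ (card B - 1 + k) * of_nat ((d + (card B - 1)) choose (card B - 1 + k)) *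
    negative_moment B k"
proof -
  let ?N = "d + (card B - 1)" and ?m = "card B - 1 + k"
  have "b ^ (d - k) = inverse b ^ k" if "b \<in> B - {0}" for b
  proof -
    have "b ^ (d - k) * b ^ k = 1"
      using k roots that by (simp flip: power_add)
    then show ?thesis using that by (simp add: field_simps)
  qed
  then have "(\<Sum>b\<in>B. lagrange_weight B b * b ^ (d - k)) = negative_moment B k"
    unfolding negative_moment_def
    using sum.remove[OF assms(1,2), of "\<lambda>b. lagrange_weight B b * b ^ (d - k)"] k
    by (simp add: power_0_left)
  moreover have "?N - ?m = d - k" by simp
  ultimately show ?thesis using k assms(3) by (simp add: coeff_stepanov_poly)
qed

section \<open>Translation and multiplicity of roots\<close>

lemma vanishing_poly_translate:
  "vanishing_poly ((\<lambda>x. x - a) ` B) = pcompose (vanishing_poly B) [:a, 1:]"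
proof -
  have "inj_on (\<lambda>x. x - a) B" by (simp add: inj_on_def)
  then show ?thesis
    unfolding vanishing_poly_def by (simp add: prod.reindex pcompose_prod pcompose_pCons)
qed

lemma lagrange_weight_translate:
  "lagrange_weight ((\<lambda>x. x - a) ` B) (b - a) = lagrange_weight B b"
proof -
  have inj: "inj_on (\<lambda>x. x - a) (B - {b})" by (simp add: inj_on_def)
  have "(\<lambda>x. x - a) ` B - {b - a} = (\<lambda>x. x - a) ` (B - {b})" by auto
  then show ?thesis
    unfolding lagrange_weight_def by (simp add: prod.reindex[OF inj])
qed

lemma pcompose_power: "pcompose (p ^ n) q = pcompose p q ^ n"
  by (induction n) (simp_all add: pcompose_mult pcompose_1)

text \<open>Powers and weights depend only on differences. Hence any point of the set can be moved
  to \<open>0\<close>, where orders of vanishing are read off from coefficients.\<close>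

lemma stepanov_poly_translate:
  "stepanov_poly ((\<lambda>x. x - a) ` B) N = pcompose (stepanov_poly B N) [:a, 1:]"
proof -
  have "inj_on (\<lambda>x. x - a) B" by (simp add: inj_on_def)
  then show ?thesis
    unfolding stepanov_poly_def
    by (simp add: sum.reindex pcompose_diff pcompose_sum pcompose_smult pcompose_1
        pcompose_power pcompose_pCons lagrange_weight_translate)
qed

text \<open>The product already split off has order \<open>0\<close> at each new point, so the
  cofactor carries the full multiplicity there.\<close>

lemma vanishing_poly_power_dvd:
  fixes p :: "'a::field poly"
  assumes "finite A" and "p \<noteq> 0" and "\<And>a. a \<in> A \<Longrightarrow> [:- a, 1:] ^ m dvd p"
  shows "vanishing_poly A ^ m dvd p"
  using assms(1,3)
proof (induction A rule: finite_induct)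
  case empty
  then show ?case by (simp add: vanishing_poly_def)
next
  case (insert a A)
  then obtain q where q: "p = vanishing_poly A ^ m * q" by (auto elim: dvdE)
  have "q \<noteq> 0" using q assms(2) by auto
  have "order a (vanishing_poly A ^ m) = 0"
    using insert.hyps by (intro order_0I) (simp add: poly_vanishing_poly_eq_0_iff poly_power)
  then have "order a p = order a q"
    using q assms(2) by (simp add: order_mult)
  moreover have "m \<le> order a p"
    using insert.prems[of a] assms(2) by (simp add: order_divides)
  ultimately have "[:- a, 1:] ^ m dvd q" by (simp add: order_divides)
  moreover have "vanishing_poly (insert a A) = [:- a, 1:] * vanishing_poly A"
    using insert.hyps by (simp add: vanishing_poly_def)
  ultimately show ?case
    unfolding q by (metis dvd_refl mult.commute mult_dvd_mono power_mult_distrib)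
qed

lemma linear_power_dvd_iff_coeff_pcompose:
  fixes p :: "'a::field poly"
  shows "[:- a, 1:] ^ m dvd p \<longleftrightarrow> (\<forall>k<m. coeff (pcompose p [:a, 1:]) k = 0)"
proof
  assume "[:- a, 1:] ^ m dvd p"
  then obtain q where "p = [:- a, 1:] ^ m * q" ..
  then have "pcompose p [:a, 1:] = monom 1 m * pcompose q [:a, 1:]"
    by (simp add: pcompose_mult pcompose_power pcompose_pCons monom_altdef)
  then show "\<forall>k<m. coeff (pcompose p [:a, 1:]) k = 0" by (simp add: coeff_monom_mult)
next
  assume "\<forall>k<m. coeff (pcompose p [:a, 1:]) k = 0"
  then have "monom 1 m dvd pcompose p [:a, 1:]" by (simp add: monom_1_dvd_iff')
  then obtain q where "pcompose p [:a, 1:] = monom 1 m * q" ..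
  then have "pcompose (pcompose p [:a, 1:]) [:- a, 1:] = pcompose (monom 1 m * q) [:- a, 1:]"
    by simp
  then have "p = [:- a, 1:] ^ m * pcompose q [:- a, 1:]"
    by (simp add: pcompose_assoc[symmetric] pcompose_mult pcompose_power pcompose_pCons monom_altdef)
  then show "[:- a, 1:] ^ m dvd p" by simp
qed

lemma translate_roots:
  assumes "\<And>x y. x \<in> A \<Longrightarrow> y \<in> A \<Longrightarrow> x \<noteq> y \<Longrightarrow> (x - y) ^ d = 1"
    and "b \<in> (\<lambda>x. x - a) ` A" and "b \<noteq> 0" and "a \<in> A"
  shows "b ^ d = (1 :: 'a::field)"
  using assms by force

text \<open>Translating each point of \<open>A\<close> to \<open>0\<close> gives the order of
  vanishing. The Taylor coefficient of order \<open>card A - 1\<close> is, up to sign, a Lagrange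
  weight times a binomial coefficient, nonzero by \<open>char\<close>; so the polynomial is not
  \<open>0\<close>.\<close>

lemma stepanov:
  fixes A :: "'a::field set"
  assumes fin: "finite A" and card: "card A \<ge> 2" and "0 < d"
    and char: "d + (card A - 1) < CHAR('a)"
    and roots: "\<And>x y. x \<in> A \<Longrightarrow> y \<in> A \<Longrightarrow> x \<noteq> y \<Longrightarrow> (x - y) ^ d = 1"
  shows "stepanov_poly A (d + (card A - 1)) \<noteq> 0"
    and "vanishing_poly A ^ (card A - 1) dvd stepanov_poly A (d + (card A - 1))"
proof -
  let ?n = "card A"
  let ?F = "stepanov_poly A (d + (?n - 1))"
  define B where "B = (\<lambda>a. (\<lambda>x. x - a) ` A)"
  have B: "finite (B a)" "card (B a) = ?n" for a
    using fin by (auto simp: B_def card_image inj_on_def)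
  have F: "stepanov_poly (B a) (d + (?n - 1)) = pcompose ?F [:a, 1:]" for a
    unfolding B_def by (rule stepanov_poly_translate)
  have Broots: "b ^ d = 1" if "a \<in> A" "b \<in> B a" "b \<noteq> 0" for a b
    using translate_roots[OF roots] that unfolding B_def by blast
  obtain a where a: "a \<in> A" using card by fastforce
  have "coeff (stepanov_poly (B a) (d + (?n - 1))) (?n - 1) =
      (- 1) ^ (?n - 1) * of_nat ((d + (?n - 1)) choose (?n - 1)) * negative_moment (B a) 0"
    using coeff_stepanov_poly_high[of "B a" d 0] B[of a] Broots[OF a] a card assms(3)
    by (auto simp: B_def)
  moreover have "negative_moment (B a) 0 \<noteq> 0"
    using negative_moment_0[of "B a"] B[of a] a card lagrange_weight_nonzero[of "B a" 0]
    by (auto simp: B_def)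
  ultimately have "coeff (stepanov_poly (B a) (d + (?n - 1))) (?n - 1) \<noteq> 0"
    using of_nat_binomial_nonzero[OF char, of "?n - 1"] by simp
  then show nz: "?F \<noteq> 0" using F[of a] by auto
  show "vanishing_poly A ^ (?n - 1) dvd ?F"
  proof (rule vanishing_poly_power_dvd[OF fin nz])
    fix a assume a: "a \<in> A"
    show "[:- a, 1:] ^ (?n - 1) dvd ?F"
      unfolding linear_power_dvd_iff_coeff_pcompose F[symmetric]
      using coeff_stepanov_poly_low[of "B a" d] B[of a] Broots[OF a] card assms(3) by simp
  qed
qed

lemma stepanov_card_bound:
  fixes A :: "'a::field set"
  assumes "finite A" and "card A \<ge> 2" and "0 < d"
    and "d + (card A - 1) < CHAR('a)"
    and "\<And>x y. x \<in> A \<Longrightarrow> y \<in> A \<Longrightarrow> x \<noteq> y \<Longrightarrow> (x - y) ^ d = 1"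
  shows "card A * (card A - 1) \<le> d"
proof -
  let ?F = "stepanov_poly A (d + (card A - 1))"
  have "card A * (card A - 1) = degree (vanishing_poly A ^ (card A - 1))"
    by (simp add: degree_power_eq vanishing_poly_nonzero degree_vanishing_poly)
  also have "\<dots> \<le> degree ?F"
    using stepanov[OF assms] by (intro dvd_imp_degree_le)
  also have "\<dots> \<le> d"
    using assms(1,2) by (intro degree_stepanov_poly) auto
  finally show ?thesis .
qed

text \<open>In this extremal case the divisor already has the maximal degree \<open>d\<close>, so
  the cofactor is constant.\<close>

lemma stepanov_poly_eq:
  fixes A :: "'a::field set"
  assumes "finite A" and "card A \<ge> 2" and "0 < d"
    and "d + (card A - 1) < CHAR('a)"
    and "\<And>x y. x \<in> A \<Longrightarrow> y \<in> A \<Longrightarrow> x \<noteq> y \<Longrightarrow> (x - y) ^ d = 1"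
    and d: "d = card A * (card A - 1)"
  shows "\<exists>C. stepanov_poly A (d + (card A - 1)) = smult C (vanishing_poly A ^ (card A - 1))"
proof -
  let ?F = "stepanov_poly A (d + (card A - 1))" and ?P = "vanishing_poly A ^ (card A - 1)"
  obtain q where q: "?F = ?P * q" using stepanov(2)[OF assms(1-5)] ..
  have nz: "q \<noteq> 0" "?P \<noteq> 0" using q stepanov(1)[OF assms(1-5)] by auto
  have "degree ?F \<le> d" using assms(1,2) by (intro degree_stepanov_poly) auto
  moreover have "degree ?F = d + degree q"
    unfolding q degree_mult_eq[OF nz(2,1)]
    by (simp add: degree_power_eq vanishing_poly_nonzero degree_vanishing_poly d)
  ultimately have "degree q = 0" by simp
  then obtain C where "q = [:C:]" by (rule degree_eq_zeroE)
  then show ?thesis using q by auto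
qed

section \<open>Local recurrences at a root\<close>

text \<open>With \<open>f = x G\<close>, coefficients of \<open>F = C f^(n-1)\<close> are compared
  from order \<open>n - 1\<close> on. The sign \<open>(- 1)^(n-1)\<close> is absorbed into the
  constant.\<close>

lemma stepanov_local_identity:
  fixes B :: "'a::field set"
  assumes fin: "finite B" and zero: "0 \<in> B" and card: "card B = n" "n \<ge> 2"
    and d: "d = n * (n - 1)"
    and char: "d + (n - 1) < CHAR('a)"
    and roots: "\<And>x y. x \<in> B \<Longrightarrow> y \<in> B \<Longrightarrow> x \<noteq> y \<Longrightarrow> (x - y) ^ d = 1"
  obtains C where "\<And>k. k < d \<Longrightarrow>
    (- 1) ^ k * of_nat ((d + (n - 1)) choose (n - 1 + k)) * negative_moment B k =
    C * coeff (vanishing_poly (B - {0}) ^ (n - 1)) k"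
proof -
  let ?F = "stepanov_poly B (d + (n - 1))" and ?G = "vanishing_poly (B - {0})"
  have d0: "0 < d" using card d by simp
  obtain C where C: "?F = smult C (vanishing_poly B ^ (n - 1))"
    using stepanov_poly_eq[of B d] fin card d0 char roots d by auto
  have "vanishing_poly B = monom 1 1 * ?G"
    using vanishing_poly_remove[OF fin zero] by (simp add: monom_altdef)
  then have "vanishing_poly B ^ (n - 1) = monom 1 (n - 1) * ?G ^ (n - 1)"
    by (simp add: power_mult_distrib monom_power)
  then have F: "coeff ?F (n - 1 + k) = C * coeff (?G ^ (n - 1)) k" for k
    by (simp add: C coeff_monom_mult del: One_nat_def)
  have roots0: "b ^ d = 1" if "b \<in> B" "b \<noteq> 0" for b
    using roots[OF that(1) zero that(2)] by simp
  show ?thesis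
  proof (rule that[of "(- 1) ^ (n - 1) * C"])
    fix k assume k: "k < d"
    have "coeff ?F (n - 1 + k) =
        (- 1) ^ (n - 1 + k) * of_nat ((d + (n - 1)) choose (n - 1 + k)) * negative_moment B k"
      using coeff_stepanov_poly_high[of B d k] fin zero card roots0 k by simp
    then have eq: "(- 1) ^ (n - 1) * ((- 1) ^ k * of_nat ((d + (n - 1)) choose (n - 1 + k)) *
        negative_moment B k) = C * coeff (?G ^ (n - 1)) k"
      using F[of k] by (simp only: power_add mult.assoc)
    have sq: "(- 1) ^ (n - 1) * ((- 1) ^ (n - 1) * x) = x" for x :: 'a
      by (simp flip: mult.assoc power_mult_distrib)
    have "(- 1) ^ (n - 1) * ((- 1) ^ (n - 1) * ((- 1) ^ k *
        of_nat ((d + (n - 1)) choose (n - 1 + k)) * negative_moment B k)) =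
        (- 1) ^ (n - 1) * (C * coeff (?G ^ (n - 1)) k)"
      unfolding eq ..
    then show "(- 1) ^ k * of_nat ((d + (n - 1)) choose (n - 1 + k)) * negative_moment B k =
        (- 1) ^ (n - 1) * C * coeff (?G ^ (n - 1)) k"
      unfolding sq by (simp only: mult.assoc)
  qed
qed

lemma binomial_next: "Suc m * (N choose Suc m) = (N - m) * (N choose m)"
  by (metis binomial_absorb_comp binomial_absorption mult.commute)

text \<open>After division by the values at \<open>0\<close>, \<open>g\<close> belongs to
  \<open>G\<close>, \<open>r\<close> to \<open>1 / G\<close> and, below order \<open>d\<close>,
  \<open>w k * r k\<close> to \<open>T = G^(n-1)\<close>; here \<open>w\<close> is a signed quotient
  of binomial coefficients. The recurrences express \<open>G * (1 / G) = 1\<close>, the ratio of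
  adjacent binomials and \<open>T' G = (n-1) G' T\<close>.\<close>

lemma stepanov_local_recurrences:
  fixes B :: "'a::field set"
  assumes fin: "finite B" and zero: "0 \<in> B" and card: "card B = n" "n \<ge> 2"
    and d: "d = n * (n - 1)"
    and char: "d + (n - 1) < CHAR('a)"
    and roots: "\<And>x y. x \<in> B \<Longrightarrow> y \<in> B \<Longrightarrow> x \<noteq> y \<Longrightarrow> (x - y) ^ d = 1"
    and g: "\<And>k. g k = coeff (vanishing_poly (B - {0})) k / coeff (vanishing_poly (B - {0})) 0"
  obtains r w where "r 0 = 1" and "w 0 = 1"
    and "\<And>k. 0 < k \<Longrightarrow> (\<Sum>i\<le>k. g i * r (k - i)) = 0"
    and "\<And>k. k < d \<Longrightarrow> of_nat (n + k) * w (Suc k) = - of_nat (d - k) * w k"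
    and "\<And>k. Suc k < d \<Longrightarrow>
      (\<Sum>i\<le>k. of_nat (Suc i) * (w (Suc i) * r (Suc i)) * g (k - i)) =
      of_nat (n - 1) * (\<Sum>i\<le>k. of_nat (Suc i) * g (Suc i) * (w (k - i) * r (k - i)))"
proof -
  let ?G = "vanishing_poly (B - {0})" and ?s = "negative_moment B"
  let ?T = "?G ^ (n - 1)" and ?N = "d + (n - 1)"
  obtain C where C: "\<And>k. k < d \<Longrightarrow>
      (- 1) ^ k * of_nat (?N choose (n - 1 + k)) * ?s k = C * coeff ?T k"
    using stepanov_local_identity[OF fin zero card d char roots] by blast
  have d0: "0 < d" using card d by simp
  have "poly ?G 0 \<noteq> 0" using fin by (simp add: poly_vanishing_poly_eq_0_iff)
  then have G0: "coeff ?G 0 \<noteq> 0" by (simp add: poly_0_coeff_0)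
  then have T0: "coeff ?T 0 \<noteq> 0" by (simp add: coeff_0_power)
  have series: "fps_of_poly ?G * Abs_fps ?s = - 1"
    using negative_moment_series[OF fin zero] card by simp
  have s0: "?s 0 \<noteq> 0"
    using negative_moment_0[OF fin zero] card lagrange_weight_nonzero[OF fin, of 0] by simp
  have b0: "(of_nat (?N choose (n - 1)) :: 'a) \<noteq> 0"
    using char by (intro of_nat_binomial_nonzero) auto
  define r where "r = (\<lambda>k. ?s k / ?s 0)"
  define w where "w = (\<lambda>k. (- 1) ^ k * of_nat (?N choose (n - 1 + k)) /
    (of_nat (?N choose (n - 1)) :: 'a))"
  define t where "t = (\<lambda>k. coeff ?T k / coeff ?T 0)"
  have C0: "of_nat (?N choose (n - 1)) * ?s 0 = C * coeff ?T 0" using C[OF d0] by simp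
  have "C \<noteq> 0" using C0 b0 s0 by auto
  \<comment> \<open>Dividing by the case \<open>k = 0\<close> eliminates the unknown constant
    \<open>C\<close>.\<close>
  have wr: "w k * r k = t k" if "k < d" for k
  proof -
    have "w k * r k = ((- 1) ^ k * of_nat (?N choose (n - 1 + k)) * ?s k) /
        (of_nat (?N choose (n - 1)) * ?s 0)"
      by (simp add: w_def r_def)
    also have "\<dots> = t k" unfolding C[OF that] C0 t_def using \<open>C \<noteq> 0\<close> by simp
    finally show ?thesis .
  qed
  have deriv: "(\<Sum>i\<le>k. of_nat (Suc i) * coeff ?T (Suc i) * coeff ?G (k - i)) =
      of_nat (n - 1) * (\<Sum>i\<le>k. of_nat (Suc i) * coeff ?G (Suc i) * coeff ?T (k - i))" for k
  proof -
    have "pderiv ?T * ?G = smult (of_nat (n - 1)) (pderiv ?G * ?T)"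
    proof -
      obtain m where m: "n - 1 = Suc m" using card by (cases "n - 1") auto
      show ?thesis unfolding m pderiv_power_Suc by (simp add: algebra_simps)
    qed
    then have "coeff (pderiv ?T * ?G) k = coeff (smult (of_nat (n - 1)) (pderiv ?G * ?T)) k"
      by simp
    then show ?thesis by (simp only: coeff_mult coeff_smult coeff_pderiv)
  qed
  show ?thesis
  proof (rule that[of r w])
    show "r 0 = 1" using s0 by (simp add: r_def)
    show "w 0 = 1" using b0 by (simp add: w_def)
    show "(\<Sum>i\<le>k. g i * r (k - i)) = 0" if "0 < k" for k
    proof -
      have "(\<Sum>i\<le>k. coeff ?G i * ?s (k - i)) = fps_nth (fps_of_poly ?G * Abs_fps ?s) k"
        by (simp add: fps_mult_nth atLeast0AtMost)
      also have "\<dots> = 0" using that by (simp add: series)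
      finally have "(\<Sum>i\<le>k. coeff ?G i * ?s (k - i)) / (coeff ?G 0 * ?s 0) = 0" by simp
      then show ?thesis by (simp add: g r_def sum_divide_distrib)
    qed
    show "of_nat (n + k) * w (Suc k) = - of_nat (d - k) * w k" if "k < d" for k
    proof -
      have "(n + k) * (?N choose (n - 1 + Suc k)) = (d - k) * (?N choose (n - 1 + k))"
        using binomial_next[of "n - 1 + k" ?N] card by simp
      then have "(of_nat (n + k) :: 'a) * of_nat (?N choose (n - 1 + Suc k)) =
          of_nat (d - k) * of_nat (?N choose (n - 1 + k))"
        by (metis of_nat_mult)
      then show ?thesis unfolding w_def times_divide_eq_right
        by (intro arg_cong2[where f = "(/)"] refl) (simp add: mult.left_commute)
    qed
    show "(\<Sum>i\<le>k. of_nat (Suc i) * (w (Suc i) * r (Suc i)) * g (k - i)) =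
        of_nat (n - 1) * (\<Sum>i\<le>k. of_nat (Suc i) * g (Suc i) * (w (k - i) * r (k - i)))"
      if "Suc k < d" for k
    proof -
      have "(\<Sum>i\<le>k. of_nat (Suc i) * (w (Suc i) * r (Suc i)) * g (k - i)) =
          (\<Sum>i\<le>k. of_nat (Suc i) * coeff ?T (Suc i) * coeff ?G (k - i)) / (coeff ?T 0 * coeff ?G 0)"
        unfolding sum_divide_distrib using that by (intro sum.cong) (simp_all add: wr t_def g)
      also have "\<dots> = of_nat (n - 1) * ((\<Sum>i\<le>k. of_nat (Suc i) * coeff ?G (Suc i) * coeff ?T (k - i)) /
          (coeff ?T 0 * coeff ?G 0))"
        unfolding deriv by simp
      also have "(\<Sum>i\<le>k. of_nat (Suc i) * coeff ?G (Suc i) * coeff ?T (k - i)) /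
          (coeff ?T 0 * coeff ?G 0) = (\<Sum>i\<le>k. of_nat (Suc i) * g (Suc i) * (w (k - i) * r (k - i)))"
        unfolding sum_divide_distrib using that
        by (intro sum.cong) (simp_all add: wr t_def g)
      finally show ?thesis .
    qed
  qed
qed

text \<open>These are the derivative recurrence at \<open>k = 1\<close> and \<open>k = 2\<close>
  with \<open>r\<close> and \<open>w\<close> eliminated. The second relation first appears with a
  factor \<open>n - 3\<close>, hence the case \<open>n = 3\<close> is excluded there.\<close>

lemma local_second_order:
  fixes B :: "'a::field set"
  assumes fin: "finite B" and zero: "0 \<in> B" and card: "card B = n" "n \<ge> 3"
    and d: "d = n * (n - 1)"
    and char: "d + (n - 1) < CHAR('a)"
    and roots: "\<And>x y. x \<in> B \<Longrightarrow> y \<in> B \<Longrightarrow> x \<noteq> y \<Longrightarrow> (x - y) ^ d = 1"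
    and g: "\<And>k. g k = coeff (vanishing_poly (B - {0})) k / coeff (vanishing_poly (B - {0})) 0"
  shows "(of_nat n - 1) * g 1 ^ 2 = 2 * of_nat n * g 2"
    and "n \<noteq> 3 \<Longrightarrow> 3 * of_nat n * g 3 = (of_nat n - 2) * g 1 * g 2"
proof -
  let ?n = "of_nat n :: 'a"
  have n2: "n \<ge> 2" using card by simp
  obtain r w where r0: "r 0 = 1" and w0: "w 0 = 1"
    and r: "\<And>k. 0 < k \<Longrightarrow> (\<Sum>i\<le>k. g i * r (k - i)) = 0"
    and w: "\<And>k. k < d \<Longrightarrow> of_nat (n + k) * w (Suc k) = - of_nat (d - k) * w k"
    and T: "\<And>k. Suc k < d \<Longrightarrow>
      (\<Sum>i\<le>k. of_nat (Suc i) * (w (Suc i) * r (Suc i)) * g (k - i)) =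
      of_nat (n - 1) * (\<Sum>i\<le>k. of_nat (Suc i) * g (Suc i) * (w (k - i) * r (k - i)))"
    using stepanov_local_recurrences[OF fin zero card(1) n2 d char roots g] by blast
  have "3 * 2 \<le> n * (n - 1)" using card by (intro mult_mono) auto
  then have d6: "6 \<le> d" using d by simp
  have "poly (vanishing_poly (B - {0})) 0 \<noteq> 0" using fin by (simp add: poly_vanishing_poly_eq_0_iff)
  then have g0: "g 0 = 1" by (simp add: g poly_0_coeff_0)
  have dn: "of_nat d = ?n * (?n - 1)" using card d by (simp add: of_nat_diff)
  have nz: "?n \<noteq> 0" "?n - 1 \<noteq> 0" "?n + 1 \<noteq> 0"
    using of_nat_nonzero_less_CHAR[where ?'a = 'a, of n]
      of_nat_nonzero_less_CHAR[where ?'a = 'a, of "n - 1"]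
      of_nat_nonzero_less_CHAR[where ?'a = 'a, of "n + 1"] card(2) char d6
    by (auto simp: of_nat_diff add.commute)
  have r1: "r 1 = - g 1" using r[of 1] g0 r0 by (simp add: add_eq_0_iff)
  have r2: "r 2 = - (g 1 * r 1 + g 2)"
    using r[of 2] g0 r0 by (simp add: numeral_2_eq_2 add_eq_0_iff algebra_simps)
  have r3: "r 3 = - (g 1 * r 2 + g 2 * r 1 + g 3)"
    using r[of 3] g0 r0 by (simp add: numeral_3_eq_3 numeral_2_eq_2 add_eq_0_iff algebra_simps)
  have "?n * w 1 = ?n * (1 - ?n)"
    using w[of 0] d6 w0 by (simp add: dn algebra_simps)
  then have w1: "w 1 = 1 - ?n" using nz by simp
  have w2: "(?n + 1) * w 2 = - (?n * (?n - 1) - 1) * w 1"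
    using w[of 1] d6 by (simp add: dn of_nat_diff numeral_2_eq_2 algebra_simps)
  have w3: "(?n + 2) * w 3 = - (?n * (?n - 1) - 2) * w 2"
    using w[of 2] d6 by (simp add: dn of_nat_diff numeral_3_eq_3 numeral_2_eq_2 algebra_simps)
  have n1: "of_nat (n - 1) = ?n - 1" using card by (simp add: of_nat_diff)
  have T1: "w 1 * r 1 * g 1 + 2 * (w 2 * r 2) = (?n - 1) * (g 1 * (w 1 * r 1) + 2 * g 2)"
    using T[of 1] d6 g0 w0 r0 n1 by (simp add: numeral_2_eq_2)
  have T2: "w 1 * r 1 * g 2 + 2 * (w 2 * r 2) * g 1 + 3 * (w 3 * r 3) =
      (?n - 1) * (g 1 * (w 2 * r 2) + 2 * g 2 * (w 1 * r 1) + 3 * g 3)"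
    using T[of 2] d6 g0 w0 r0 n1 by (simp add: numeral_2_eq_2 numeral_3_eq_3)
  have "(?n - 1) * (?n * ((?n - 1) * g 1 ^ 2 - 2 * ?n * g 2)) = 0"
    using T1 r1 r2 w1 w2 by Groebner_Basis.algebra
  then show second: "(?n - 1) * g 1 ^ 2 = 2 * ?n * g 2" using nz by simp
  assume n3: "n \<noteq> 3"
  have nz3: "?n - 3 \<noteq> 0"
    using of_nat_nonzero_less_CHAR[where ?'a = 'a, of "n - 3"] card(2) n3 char by (auto simp: of_nat_diff)
  have w2': "(?n + 1) * w 2 = (?n - 1) * (?n * (?n - 1) - 1)"
    using w2 unfolding w1 by Groebner_Basis.algebra
  \<comment> \<open>Since \<open>n (n-1) - 2 = (n+1) (n-2)\<close>, the known product
    \<open>(n+1) * w 2\<close> reappears.\<close>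
  have "(?n + 2) * w 3 = - (?n - 2) * ((?n + 1) * w 2)"
    using w3 by Groebner_Basis.algebra
  then have w3': "(?n + 2) * w 3 = - (?n - 2) * ((?n - 1) * (?n * (?n - 1) - 1))"
    unfolding w2' .
  define X where "X = (?n + 1) * w 2"
  define Y where "Y = (?n + 2) * w 3"
  have T2': "(1 - ?n) * (- g 1) * g 2 + 2 * (w 2 * (g 1 ^ 2 - g 2)) * g 1 +
      3 * (w 3 * (2 * g 1 * g 2 - g 1 ^ 3 - g 3)) =
      (?n - 1) * (g 1 * (w 2 * (g 1 ^ 2 - g 2)) + 2 * g 2 * ((1 - ?n) * (- g 1)) + 3 * g 3)"
    using T2 unfolding r3 r2 r1 w1 by (simp add: algebra_simps power2_eq_square power3_eq_cube)
  \<comment> \<open>Multiplying by \<open>(n+1) (n+2)\<close> lets \<open>w 2\<close> and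
    \<open>w 3\<close> occur only through \<open>X\<close> and \<open>Y\<close>, whose values are
    known.\<close>
  have "(?n + 1) * (?n + 2) * ((?n - 1) * (3 - 2 * ?n) * g 1 * g 2 - 3 * (?n - 1) * g 3) +
      (3 - ?n) * g 1 * (g 1 ^ 2 - g 2) * (?n + 2) * X +
      3 * (2 * g 1 * g 2 - g 1 ^ 3 - g 3) * (?n + 1) * Y = 0"
    using T2' unfolding X_def Y_def by Groebner_Basis.algebra
  \<comment> \<open>The third order relation times nonzero factors, plus a multiple of the second
    order one.\<close>
  then have "(?n - 1) * (?n + 1) * ?n * (?n - 3) * (3 * ?n * g 3 - (?n - 2) * g 1 * g 2) +
      2 * (?n - 1) * ?n * (?n * (?n - 1) - 1) * g 1 * ((?n - 1) * g 1 ^ 2 - 2 * ?n * g 2) = 0"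
    unfolding X_def Y_def w2' w3' by Groebner_Basis.algebra
  then have "(?n - 1) * (?n + 1) * ?n * (?n - 3) * (3 * ?n * g 3 - (?n - 2) * g 1 * g 2) = 0"
    unfolding second by simp
  then show "3 * ?n * g 3 = (?n - 2) * g 1 * g 2" using nz nz3 by simp
qed

text \<open>
  The only prime factors of \<open>109 \<cdot> 108 \<cdot> 107 \<cdot> 106 - 12 \<cdot> 13 \<cdot> 14 \<cdot> 15\<close> are
  \<open>2, 3, 11, 47, 163\<close>, all smaller than the characteristic.
\<close>

lemma local_fifth_order:
  fixes B :: "'a::field set"
  assumes fin: "finite B" and zero: "0 \<in> B" and card: "card B = 11"
    and char: "220 < CHAR('a)"
    and roots: "\<And>x y. x \<in> B \<Longrightarrow> y \<in> B \<Longrightarrow> x \<noteq> y \<Longrightarrow> (x - y) ^ 110 = 1"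
    and low: "\<And>k. 0 < k \<Longrightarrow> k < 5 \<Longrightarrow> coeff (vanishing_poly (B - {0})) k = 0"
  shows "coeff (vanishing_poly (B - {0})) 5 = 0"
proof -
  define g where "g = (\<lambda>k. coeff (vanishing_poly (B - {0})) k / coeff (vanishing_poly (B - {0})) 0)"
  have n2: "(11::nat) \<ge> 2" and d: "(110::nat) = 11 * (11 - 1)" and char': "110 + (11 - 1) < CHAR('a)"
    using char by simp_all
  obtain r w where r0: "r 0 = 1" and w0: "w 0 = 1"
    and r: "\<And>k. 0 < k \<Longrightarrow> (\<Sum>i\<le>k. g i * r (k - i)) = 0"
    and w: "\<And>k. k < 110 \<Longrightarrow> of_nat (11 + k) * w (Suc k) = - of_nat (110 - k) * w k"
    and T: "\<And>k. Suc k < 110 \<Longrightarrow>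
      (\<Sum>i\<le>k. of_nat (Suc i) * (w (Suc i) * r (Suc i)) * g (k - i)) =
      of_nat (11 - 1) * (\<Sum>i\<le>k. of_nat (Suc i) * g (Suc i) * (w (k - i) * r (k - i)))"
    using stepanov_local_recurrences[OF fin zero card n2 d char' roots, of g] unfolding g_def by blast
  have "poly (vanishing_poly (B - {0})) 0 \<noteq> 0" using fin by (simp add: poly_vanishing_poly_eq_0_iff)
  then have G0: "coeff (vanishing_poly (B - {0})) 0 \<noteq> 0" by (simp add: poly_0_coeff_0)
  then have g0: "g 0 = 1" by (simp add: g_def)
  have g: "g 1 = 0" "g 2 = 0" "g 3 = 0" "g 4 = 0" using low by (simp_all add: g_def)
  have r1: "r 1 = 0" using r[of 1] g0 r0 g by simp
  have r2: "r 2 = 0" using r[of 2] g0 r0 g r1 by (simp add: eval_nat_numeral)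
  have r3: "r 3 = 0" using r[of 3] g0 r0 g r1 r2 by (simp add: eval_nat_numeral)
  have r4: "r 4 = 0" using r[of 4] g0 r0 g r1 r2 r3 by (simp add: eval_nat_numeral)
  have r5: "r 5 = - g 5"
    using r[of 5] g0 r0 g r1 r2 r3 r4 by (simp add: eval_nat_numeral add_eq_0_iff)
  have w1: "11 * w 1 = - 110" using w[of 0] w0 by simp
  have w2: "12 * w 2 = - 109 * w 1" using w[of 1] by (simp add: numeral_2_eq_2)
  have w3: "13 * w 3 = - 108 * w 2" using w[of 2] by (simp add: numeral_3_eq_3)
  have w4: "14 * w 4 = - 107 * w 3" using w[of 3] by (simp add: eval_nat_numeral)
  have w5: "15 * w 5 = - 106 * w 4" using w[of 4] by (simp add: eval_nat_numeral)
  have T4: "5 * (w 5 * r 5) = 10 * (5 * g 5)"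
    using T[of 4] g0 w0 g r1 r2 r3 r4 r0 by (simp add: eval_nat_numeral)
  \<comment> \<open>Denominators are cleared step by step, up to
    \<open>360360 = 11 * 12 * 13 * 14 * 15\<close> and
    \<open>14686982640 = 110 * 109 * 108 * 107 * 106\<close>.\<close>
  have "11 * (12 * w 2) = - 109 * (11 * w 1)" by (simp add: w2)
  then have v2: "132 * w 2 = 11990" unfolding w1 by simp
  have "132 * (13 * w 3) = - 108 * (132 * w 2)" by (simp add: w3)
  then have v3: "1716 * w 3 = - 1294920" unfolding v2 by simp
  have "1716 * (14 * w 4) = - 107 * (1716 * w 3)" by (simp add: w4)
  then have v4: "24024 * w 4 = 138556440" unfolding v3 by simp
  have "24024 * (15 * w 5) = - 106 * (24024 * w 4)" by (simp add: w5)
  then have v5: "360360 * w 5 = - 14686982640" unfolding v4 by simp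
  have "5 * (360360 * w 5) * g 5 = - (360360 * (5 * (w 5 * r 5)))" by (simp add: r5)
  then have "(5 * 14686982640 - 5 * 10 * 360360) * g 5 = 0"
    unfolding T4 v5 by Groebner_Basis.algebra
  \<comment> \<open>Each factor written out is below \<open>220\<close>, hence nonzero in the
    field.\<close>
  moreover have "(5 * 14686982640 - 5 * 10 * 360360 :: 'a) =
      5 * (110 * (16 * (9 * (121 * (47 * 163)))))" by simp
  ultimately have "5 * (110 * (16 * (9 * (121 * (47 * 163))))) * g 5 = 0" by (simp only:)
  then have "g 5 = 0" using char by (simp only: mult_eq_0_iff) (simp add: numeral_nonzero_less_CHAR)
  then show ?thesis using G0 by (simp add: g_def)
qed

section \<open>A differential equation for the vanishing polynomial\<close>

text \<open>
  Up to a scalar, this is the fourth transvectant \<open>(P, P)\<^sub>4\<close> of the binary form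
  \<open>P(x, y) = y f(x, y)\<close> of degree \<open>n + 1\<close>, dehomogenised at \<open>y = 1\<close>. The exceptions
  \<open>n + 1 = 6, 12\<close> below arise because it vanishes for the octahedral and icosahedral forms.
\<close>

definition fourth_transvectant :: "nat \<Rightarrow> 'a::field poly \<Rightarrow> 'a poly" where
  "fourth_transvectant n f =
    smult (of_nat n * (of_nat n + 1)) (f * (pderiv ^^ 4) f) -
    smult (4 * of_nat n * (of_nat n - 2)) ((pderiv ^^ 1) f * (pderiv ^^ 3) f) +
    smult (3 * (of_nat n - 1) * (of_nat n - 2)) ((pderiv ^^ 2) f * (pderiv ^^ 2) f)"

lemma pderiv_pcompose_linear: "pderiv (pcompose p [:a, 1:]) = pcompose (pderiv p) [:a, 1:]"
  by (simp add: pderiv_pcompose pderiv_pCons)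

lemma higher_pderiv_pcompose_linear:
  "(pderiv ^^ k) (pcompose p [:a, 1:]) = pcompose ((pderiv ^^ k) p) [:a, 1:]"
  by (induction k) (simp_all add: pderiv_pcompose_linear)

lemma fourth_transvectant_pcompose_linear:
  "fourth_transvectant n (pcompose f [:a, 1:]) = pcompose (fourth_transvectant n f) [:a, 1:]"
  unfolding fourth_transvectant_def
  by (simp only: higher_pderiv_pcompose_linear pcompose_add pcompose_diff pcompose_smult pcompose_mult)

text \<open>With \<open>h = x G\<close> and \<open>g k = coeff h (k+1) / coeff h 1\<close>, the last
  factors are the two relations of \<open>local_second_order\<close>, cleared of
  denominators.\<close>

lemma fourth_transvectant_low_coeffs:
  fixes h :: "'a::field poly"
  assumes "coeff h 0 = 0"
  shows "coeff (fourth_transvectant n h) 0 =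
      12 * (of_nat n - 2) * ((of_nat n - 1) * coeff h 2 ^ 2 - 2 * of_nat n * coeff h 1 * coeff h 3)"
    and "coeff (fourth_transvectant n h) 1 =
      24 * (of_nat n - 3) * ((of_nat n - 2) * coeff h 2 * coeff h 3 - 3 * of_nat n * coeff h 1 * coeff h 4)"
proof -
  have 1: "coeff ((pderiv ^^ 1) h) 0 = coeff h 1" "coeff ((pderiv ^^ 1) h) 1 = 2 * coeff h 2"
    by (simp_all add: coeff_pderiv numeral_2_eq_2)
  have 2: "coeff ((pderiv ^^ 2) h) 0 = 2 * coeff h 2" "coeff ((pderiv ^^ 2) h) 1 = 6 * coeff h 3"
    by (simp_all add: coeff_pderiv eval_nat_numeral)
  have 3: "coeff ((pderiv ^^ 3) h) 0 = 6 * coeff h 3" "coeff ((pderiv ^^ 3) h) 1 = 24 * coeff h 4"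
    by (simp_all add: coeff_pderiv eval_nat_numeral)
  have 4: "coeff ((pderiv ^^ 4) h) 0 = 24 * coeff h 4"
    by (simp add: coeff_pderiv eval_nat_numeral)
  have prod1: "coeff (p * q) 1 = coeff p 0 * coeff q 1 + coeff p 1 * coeff q 0" for p q :: "'a poly"
    by (simp add: coeff_mult)
  have prod0: "coeff (p * q) 0 = coeff p 0 * coeff q 0" for p q :: "'a poly"
    by (simp add: coeff_mult)
  show "coeff (fourth_transvectant n h) 0 =
      12 * (of_nat n - 2) * ((of_nat n - 1) * coeff h 2 ^ 2 - 2 * of_nat n * coeff h 1 * coeff h 3)"
    unfolding fourth_transvectant_def coeff_add coeff_diff coeff_smult prod0 1 2 3 4 assms
    by Groebner_Basis.algebra
  show "coeff (fourth_transvectant n h) 1 =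
      24 * (of_nat n - 3) * ((of_nat n - 2) * coeff h 2 * coeff h 3 - 3 * of_nat n * coeff h 1 * coeff h 4)"
    unfolding fourth_transvectant_def coeff_add coeff_diff coeff_smult prod1 1 2 3 4 assms
    by Groebner_Basis.algebra
qed

lemma degree_higher_pderiv_le: "degree ((pderiv ^^ k) p) \<le> degree p - k"
proof (induction k)
  case (Suc k)
  have "degree (pderiv ((pderiv ^^ k) p)) \<le> degree ((pderiv ^^ k) p) - 1" by (rule degree_pderiv_le)
  with Suc show ?case by simp
qed simp

text \<open>Moving a root to \<open>0\<close>, the local relations kill the first two Taylor
  coefficients. So \<open>f^2\<close>, of degree \<open>2 n\<close>, divides the transvectant, each
  of whose products loses at least one degree against \<open>2 n\<close>.\<close>

lemma fourth_transvectant_eq_0: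
  fixes A :: "'a::field set"
  assumes fin: "finite A" and card: "card A = n" "n \<ge> 4"
    and d: "d = n * (n - 1)"
    and char: "d + (n - 1) < CHAR('a)"
    and roots: "\<And>x y. x \<in> A \<Longrightarrow> y \<in> A \<Longrightarrow> x \<noteq> y \<Longrightarrow> (x - y) ^ d = 1"
  shows "fourth_transvectant n (vanishing_poly A) = 0"
proof (rule ccontr)
  let ?f = "vanishing_poly A" and ?n = "of_nat n :: 'a"
  let ?L = "fourth_transvectant n ?f"
  assume nz: "?L \<noteq> 0"
  have "vanishing_poly A ^ 2 dvd ?L"
  proof (rule vanishing_poly_power_dvd[OF fin nz])
    fix a assume a: "a \<in> A"
    define B where "B = (\<lambda>x. x - a) ` A"
    define h where "h = vanishing_poly B"
    define g where "g = (\<lambda>k. coeff (vanishing_poly (B - {0})) k / coeff (vanishing_poly (B - {0})) 0)"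
    have B: "finite B" "0 \<in> B" "card B = n"
      using fin a card by (auto simp: B_def card_image inj_on_def)
    have Broots: "(x - y) ^ d = 1" if "x \<in> B" "y \<in> B" "x \<noteq> y" for x y
      using that roots by (auto simp: B_def)
    have n3: "n \<ge> 3" "n \<noteq> 3" using card by auto
    have h: "h = pCons 0 (vanishing_poly (B - {0}))"
      using vanishing_poly_remove[OF B(1,2)] by (simp add: h_def)
    have "poly (vanishing_poly (B - {0})) 0 \<noteq> 0" using B by (simp add: poly_vanishing_poly_eq_0_iff)
    then have h1: "coeff h 1 \<noteq> 0" by (simp add: h poly_0_coeff_0)
    have "g 1 = coeff h 2 / coeff h 1" "g 2 = coeff h 3 / coeff h 1" "g 3 = coeff h 4 / coeff h 1"
      by (simp_all add: g_def h eval_nat_numeral)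
    then have gh: "coeff h 2 = g 1 * coeff h 1" "coeff h 3 = g 2 * coeff h 1" "coeff h 4 = g 3 * coeff h 1"
      using h1 by simp_all
    have g: "(?n - 1) * g 1 ^ 2 = 2 * ?n * g 2" "3 * ?n * g 3 = (?n - 2) * g 1 * g 2"
      using local_second_order[OF B n3(1) d char Broots, of g] n3(2) by (simp_all add: g_def)
    have "(?n - 1) * coeff h 2 ^ 2 = ((?n - 1) * g 1 ^ 2) * coeff h 1 ^ 2"
      by (simp add: gh power_mult_distrib)
    then have second: "(?n - 1) * coeff h 2 ^ 2 = 2 * ?n * coeff h 1 * coeff h 3"
      unfolding g(1) gh(2) by (simp add: power2_eq_square)
    have "3 * ?n * coeff h 1 * coeff h 4 = (3 * ?n * g 3) * coeff h 1 ^ 2"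
      by (simp add: gh power2_eq_square)
    then have third: "(?n - 2) * coeff h 2 * coeff h 3 = 3 * ?n * coeff h 1 * coeff h 4"
      unfolding g(2) gh(1,2) by (auto simp: power2_eq_square)
    have h0: "coeff h 0 = 0" by (simp add: h)
    have "pcompose ?L [:a, 1:] = fourth_transvectant n h"
      unfolding h_def B_def vanishing_poly_translate fourth_transvectant_pcompose_linear ..
    moreover have "coeff (fourth_transvectant n h) 0 = 0" "coeff (fourth_transvectant n h) 1 = 0"
      unfolding fourth_transvectant_low_coeffs[OF h0] second third by simp_all
    ultimately show "[:- a, 1:] ^ 2 dvd ?L"
      unfolding linear_power_dvd_iff_coeff_pcompose by (auto simp: less_2_cases_iff)
  qed
  then have "2 * n \<le> degree ?L"
    using dvd_imp_degree_le[OF _ nz] card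
    by (fastforce simp: degree_power_eq vanishing_poly_nonzero degree_vanishing_poly)
  moreover have "degree ?L \<le> 2 * n - 1"
  proof -
    have D: "degree ((pderiv ^^ k) ?f) \<le> n - k" for k
      using degree_higher_pderiv_le[of k ?f] card by (simp add: degree_vanishing_poly)
    have "degree (p * q) \<le> 2 * n - 1" if "degree p \<le> n" "degree q \<le> n - 1" for p q :: "'a poly"
      using degree_mult_le[of p q] that card by linarith
    moreover have "degree ?f \<le> n" "degree ((pderiv ^^ 1) ?f) \<le> n"
      "degree ((pderiv ^^ 2) ?f) \<le> n - 1" "degree ((pderiv ^^ 2) ?f) \<le> n"
      "degree ((pderiv ^^ 3) ?f) \<le> n - 1" "degree ((pderiv ^^ 4) ?f) \<le> n - 1"
      using D[of 1] D[of 2] D[of 3] D[of 4] card by (auto simp: degree_vanishing_poly)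
    ultimately show ?thesis
      unfolding fourth_transvectant_def
      by (intro degree_add_le degree_diff_le order_trans[OF degree_smult_le]) blast+
  qed
  ultimately show False using card by linarith
qed

section \<open>Euler operators and the indicial equation\<close>

text \<open>
  Multiplying the transvectant by \<open>x\<^sup>4\<close> turns every factor into such an operator, which acts
  diagonally on monomials.
\<close>

definition euler_power :: "nat \<Rightarrow> 'a::field poly \<Rightarrow> 'a poly" where
  "euler_power k p = monom 1 k * (pderiv ^^ k) p"

text \<open>This is \<open>x^(k+1) D^(k+1) = (x D - k) x^k D^k\<close>; as \<open>x D\<close>
  multiplies \<open>x^i\<close> by \<open>i\<close>, iteration yields falling factorials.\<close>

lemma euler_power_Suc:
  "euler_power (Suc k) p = monom 1 1 * pderiv (euler_power k p) - smult (of_nat k) (euler_power k p)"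
proof (cases k)
  case (Suc l)
  let ?q = "(pderiv ^^ k) p"
  have D: "pderiv (monom 1 k) = monom (of_nat k :: 'a) l" by (simp add: pderiv_monom Suc)
  have m: "monom (1::'a) 1 * monom 1 k = monom 1 (Suc k)"
    "monom (1::'a) 1 * monom (of_nat k) l = smult (of_nat k) (monom 1 k)"
    by (simp_all add: mult_monom smult_monom Suc)
  have "monom 1 1 * pderiv (monom 1 k * ?q) =
      (monom 1 1 * monom 1 k) * pderiv ?q + (monom 1 1 * monom (of_nat k) l) * ?q"
    by (simp only: pderiv_mult D distrib_left mult_ac)
  then show ?thesis unfolding m euler_power_def by simp
qed (simp add: euler_power_def)

lemma coeff_euler_power:
  "coeff (euler_power k p) i = (\<Prod>l<k. of_nat i - of_nat l) * coeff p i"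
proof (induction k)
  case (Suc k)
  have X: "coeff (monom 1 1 * pderiv q) i = of_nat i * coeff q i" for q :: "'a poly"
    by (cases i) (simp_all add: coeff_monom_mult coeff_pderiv)
  show ?case
    unfolding euler_power_Suc coeff_diff coeff_smult X Suc by (simp add: algebra_simps)
qed (simp add: euler_power_def)

lemma euler_power_fourth_transvectant:
  "monom 1 4 * fourth_transvectant n f =
    smult (of_nat n * (of_nat n + 1)) (euler_power 0 f * euler_power 4 f) -
    smult (4 * of_nat n * (of_nat n - 2)) (euler_power 1 f * euler_power 3 f) +
    smult (3 * (of_nat n - 1) * (of_nat n - 2)) (euler_power 2 f * euler_power 2 f)"
proof -
  have m: "monom (1::'a) 4 * (p * q) = (monom 1 i * p) * (monom 1 j * q)" if "i + j = 4" for i j p q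
  proof -
    have "monom (1::'a) 4 = monom 1 i * monom 1 j" using that by (simp add: mult_monom)
    then show ?thesis by (simp add: mult_ac)
  qed
  have "monom 1 4 * (f * (pderiv ^^ 4) f) = euler_power 0 f * euler_power 4 f"
    using m[of 0 4] by (simp add: euler_power_def)
  moreover have "monom 1 4 * ((pderiv ^^ 1) f * (pderiv ^^ 3) f) = euler_power 1 f * euler_power 3 f"
    unfolding euler_power_def by (rule m) simp
  moreover have "monom 1 4 * ((pderiv ^^ 2) f * (pderiv ^^ 2) f) = euler_power 2 f * euler_power 2 f"
    unfolding euler_power_def by (rule m) simp
  ultimately show ?thesis
    unfolding fourth_transvectant_def by (simp only: distrib_left right_diff_distrib mult_smult_right)
qed

text \<open>Apart from \<open>n\<close>, exponents are at most \<open>e\<close>, and two of those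
  sum to less than \<open>n + j\<close>. Keeping \<open>e\<close> apart from \<open>j\<close> allows
  \<open>j\<close> to lie below the second highest exponent.\<close>

lemma coeff_mult_top_terms:
  fixes p q :: "'a::field poly"
  assumes "\<And>i. i < n \<Longrightarrow> e < i \<Longrightarrow> coeff p i = 0" and "\<And>i. i < n \<Longrightarrow> e < i \<Longrightarrow> coeff q i = 0"
    and "degree p \<le> n" and "degree q \<le> n" and "2 * e < n + j" and "j < n"
  shows "coeff (p * q) (n + j) = coeff p n * coeff q j + coeff p j * coeff q n"
proof -
  have "coeff (p * q) (n + j) = (\<Sum>i\<le>n + j. coeff p i * coeff q (n + j - i))"
    by (rule coeff_mult)
  also have "\<dots> = (\<Sum>i\<in>{n, j}. coeff p i * coeff q (n + j - i))"
  proof (rule sum.mono_neutral_right)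
    show "\<forall>i\<in>{..n + j} - {n, j}. coeff p i * coeff q (n + j - i) = 0"
    proof
      fix i assume i: "i \<in> {..n + j} - {n, j}"
      have "coeff p i = 0 \<or> coeff q (n + j - i) = 0"
      proof (cases "n < i \<or> e < i \<and> i < n")
        case True
        then show ?thesis using assms(1)[of i] assms(3) by (auto intro: coeff_eq_0)
      next
        case False
        then have "i \<le> e" "i < n" using i by auto
        then have "e < n + j - i" "n + j - i \<noteq> n" using assms(5) i by auto
        then show ?thesis
          using assms(2)[of "n + j - i"] assms(4) coeff_eq_0[of q "n + j - i"]
          by (cases "n + j - i < n") auto
      qed
      then show "coeff p i * coeff q (n + j - i) = 0" by auto
    qed
  qed (use assms in auto)
  also have "\<dots> = coeff p n * coeff q j + coeff p j * coeff q n" using assms(6) by simp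
  finally show ?thesis .
qed

text \<open>The coefficient of \<open>x^(n+j)\<close> in \<open>x^4 L\<close> factors. The bound on
  the characteristic and \<open>j + 2 \<le> n\<close> keep \<open>j - n\<close> and
  \<open>j - n \<plusminus> 1\<close> nonzero, which leaves an equation linear in
  \<open>j\<close>.\<close>

lemma fourth_transvectant_indicial:
  fixes f :: "'a::field poly"
  assumes L: "fourth_transvectant n f = 0" and lead: "degree f = n" "coeff f n = 1"
    and gap: "\<And>i. i < n \<Longrightarrow> e < i \<Longrightarrow> coeff f i = 0"
    and e: "2 * e < n + j" and j: "j + 2 \<le> n" and char: "n * (n - 1) + (n - 1) < CHAR('a)"
    and nz: "coeff f j \<noteq> 0"
  shows "(n + 1) * j = (n - 2) * (n - 3)"
proof -
  let ?n = "of_nat n :: 'a" and ?j = "of_nat j :: 'a"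
  have "degree (euler_power k f) \<le> n" for k
    by (rule degree_le) (auto simp: coeff_euler_power coeff_eq_0 lead)
  then have P: "coeff (euler_power k f * euler_power l f) (n + j) =
      coeff (euler_power k f) n * coeff (euler_power l f) j +
      coeff (euler_power k f) j * coeff (euler_power l f) n" for k l
    using e j by (intro coeff_mult_top_terms[where e = e]) (auto simp: coeff_euler_power gap)
  have falling: "(\<Prod>l<0. x - of_nat l) = 1" "(\<Prod>l<1. x - of_nat l) = x"
    "(\<Prod>l<2. x - of_nat l) = x * (x - 1)" "(\<Prod>l<3. x - of_nat l) = x * (x - 1) * (x - 2)"
    "(\<Prod>l<4. x - of_nat l) = x * (x - 1) * (x - 2) * (x - 3)" for x :: 'a
    by (simp_all add: eval_nat_numeral)
  have "coeff (monom 1 4 * fourth_transvectant n f) (n + j) =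
      ?n * (?j - ?n) * (?j - ?n + 1) * (?j - ?n - 1) *
      ((?n + 1) * ?j - (?n - 2) * (?n - 3)) * coeff f j"
    unfolding euler_power_fourth_transvectant coeff_add coeff_diff coeff_smult P coeff_euler_power
      falling lead(2)
    by Groebner_Basis.algebra
  then have "?n * (?j - ?n) * (?j - ?n + 1) * (?j - ?n - 1) *
      ((?n + 1) * ?j - (?n - 2) * (?n - 3)) * coeff f j = 0"
    by (simp add: L)
  moreover have n2: "2 \<le> n" using j by simp
  have "2 * (n - 1) \<le> n * (n - 1)" using n2 by (intro mult_le_mono) auto
  then have nC: "n + 1 < CHAR('a)" using n2 char by linarith
  have jC: "n - j < CHAR('a)" "n - j - 1 < CHAR('a)" "n - j + 1 < CHAR('a)" using nC by linarith+
  have "?n \<noteq> 0" using of_nat_nonzero_less_CHAR[where ?'a = 'a, of n] n2 nC by auto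
  moreover have "?j - ?n \<noteq> 0"
    using of_nat_nonzero_less_CHAR[where ?'a = 'a, of "n - j"] j jC by (auto simp: of_nat_diff)
  moreover have "?j - ?n + 1 \<noteq> 0"
    using of_nat_nonzero_less_CHAR[where ?'a = 'a, of "n - j - 1"] j jC
    by (auto simp: of_nat_diff algebra_simps)
  moreover have "?j - ?n - 1 \<noteq> 0"
    using of_nat_nonzero_less_CHAR[where ?'a = 'a, of "n - j + 1"] j jC
    by (auto simp: of_nat_diff algebra_simps)
  ultimately have *: "(?n + 1) * ?j = (?n - 2) * (?n - 3)" using nz by simp
  show ?thesis
  \<comment> \<open>For \<open>n = 2\<close> the truncated \<open>n - 3\<close> differs from the
    field value. Otherwise both sides are below the characteristic, so the equation lifts to the
    naturals.\<close>
  proof (cases "n = 2")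
    case True
    then have "j = 0" using j by simp
    then show ?thesis using True by simp
  next
    case False
    then have n3: "3 \<le> n" using n2 by simp
    have "of_nat ((n + 1) * j) = (of_nat ((n - 2) * (n - 3)) :: 'a)"
      using * n3 by (simp add: of_nat_diff distrib_right add.commute)
    moreover have "(n + 1) * j < CHAR('a)"
    proof -
      have "(n + 1) * j \<le> (n + 1) * (n - 2)" using j by (intro mult_le_mono) auto
      also have "\<dots> \<le> n * (n - 1)" using n3 by (simp add: diff_mult_distrib2 algebra_simps)
      finally show ?thesis using char by simp
    qed
    moreover have "(n - 2) * (n - 3) < CHAR('a)"
    proof -
      have "(n - 2) * (n - 3) \<le> n * (n - 1)" by (intro mult_le_mono) auto
      then show ?thesis using char by simp
    qed
    ultimately show ?thesis unfolding of_nat_eq_iff_cong_CHAR cong_def by (simp only: mod_less)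
  qed
qed

text \<open>With \<open>n = m + 4\<close> the equation becomes
  \<open>(m + 5) (j - m + 2) = 12\<close>, so \<open>n + 1\<close> divides
  \<open>12\<close>.\<close>

lemma indicial_solutions:
  assumes "(n + 1) * j = (n - 2) * (n - 3)" and "4 \<le> (n::nat)"
  shows "n = 5 \<and> j = 1 \<or> n = 11 \<and> j = 6"
proof -
  obtain m where m: "n = m + 4" using assms(2) by (metis add.commute le_Suc_ex)
  have "int (m + 5) * int j = int (m + 2) * int (m + 1)"
    using assms(1) unfolding m by (simp add: algebra_simps flip: of_nat_mult of_nat_add)
  then have "int (m + 5) * (int j - int m + 2) = 12" by (simp add: algebra_simps)
  then have "int (m + 5) dvd 12" by (metis dvd_triv_left)
  then have "m \<le> 7" by (drule_tac zdvd_imp_le) auto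
  then have "m \<in> {0,1,2,3,4,5,6,7}" by auto
  then show ?thesis using assms(1) unfolding m by (elim insertE emptyE; simp; presburger)
qed

section \<open>The exceptional cardinalities\<close>

lemma coeff_vanishing_poly_subleading:
  assumes "finite A" and "A \<noteq> {}"
  shows "coeff (vanishing_poly A) (card A - 1) = - \<Sum>A"
  using assms
proof (induction A rule: finite_ne_induct)
  case (singleton a)
  then show ?case by (simp add: vanishing_poly_def)
next
  case (insert a A)
  obtain m where m: "card A = Suc m" using insert.hyps by (cases "card A") auto
  have "vanishing_poly (insert a A) = [:- a, 1:] * vanishing_poly A"
    using insert.hyps by (simp add: vanishing_poly_def)
  moreover have "coeff (vanishing_poly A) (Suc m) = 1"
    using lead_coeff_vanishing_poly[of A] by (simp add: degree_vanishing_poly m)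
  moreover have "coeff (vanishing_poly A) m = - \<Sum>A" using insert.IH by (simp add: m)
  ultimately show ?case using insert.hyps by (simp add: m)
qed

lemma no_large_centred_set:
  fixes A :: "'a::field set"
  assumes fin: "finite A" and card: "card A = n" "n \<ge> 4"
    and d: "d = n * (n - 1)"
    and char: "2 * d < CHAR('a)"
    and roots: "\<And>x y. x \<in> A \<Longrightarrow> y \<in> A \<Longrightarrow> x \<noteq> y \<Longrightarrow> (x - y) ^ d = 1"
    and inj: "\<And>x y u v. \<lbrakk>x \<in> A; y \<in> A; u \<in> A; v \<in> A; x \<noteq> y; x - y = u - v\<rbrakk> \<Longrightarrow> x = u"
    and centre: "\<Sum>A = 0"
  shows False
proof -
  let ?f = "vanishing_poly A"
  have "1 * (n - 1) \<le> n * (n - 1)" using card by (intro mult_le_mono) auto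
  then have char': "d + (n - 1) < CHAR('a)" using char d by linarith
  have L: "fourth_transvectant n ?f = 0"
    by (rule fourth_transvectant_eq_0[OF fin card d char' roots])
  have deg: "degree ?f = n" and lead: "coeff ?f n = 1"
    using lead_coeff_vanishing_poly[of A] card by (simp_all add: degree_vanishing_poly)
  have "A \<noteq> {}" using card by auto
  then have sub: "coeff ?f (n - 1) = 0"
    using coeff_vanishing_poly_subleading[OF fin] card centre by simp
  define r where "r = ?f - monom 1 n"
  have r: "coeff r i = (if i = n then 0 else coeff ?f i)" for i
    by (simp add: r_def lead)
  have "r \<noteq> 0"
  proof
    assume "r = 0"
    then have "?f = monom 1 n" by (simp add: r_def)
    then have "A \<subseteq> {0}"
      using poly_vanishing_poly_eq_0_iff[OF fin] by (auto simp: poly_monom)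
    then have "card A \<le> card {0::'a}" by (intro card_mono) auto
    then show False using card by simp
  qed
  define j where "j = degree r"
  have rj: "coeff r j \<noteq> 0" using \<open>r \<noteq> 0\<close> by (simp add: j_def)
  have "\<not> j > n"
  proof
    assume "j > n"
    then have "coeff r j = 0" using deg by (simp add: r coeff_eq_0)
    with rj show False ..
  qed
  moreover have "j \<noteq> n" "j \<noteq> n - 1" using rj sub r by metis+
  ultimately have jn: "j + 2 \<le> n" by linarith
  have fj: "coeff ?f j \<noteq> 0" using rj jn by (simp add: r)
  have gap: "coeff ?f i = 0" if "i < n" "j < i" for i
    using coeff_eq_0[of r i] that by (simp add: j_def r)
  \<comment> \<open>The equation determines \<open>i\<close>, so besides \<open>j\<close> itself no
    exponent \<open>i\<close> in this range occurs: \<open>i = 0\<close> is excluded for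
    \<open>n = 5\<close>, and \<open>1 < i < 6\<close> for \<open>n = 11\<close>.\<close>
  have indicial: "(n + 1) * i = (n - 2) * (n - 3)"
    if "2 * j < n + i" "i + 2 \<le> n" "coeff ?f i \<noteq> 0" for i
    using fourth_transvectant_indicial[OF L deg lead gap that(1,2) _ that(3)] char' d by simp
  have "(n + 1) * j = (n - 2) * (n - 3)"
    using indicial[OF _ jn fj] jn by linarith
  then consider "n = 5" "j = 1" | "n = 11" "j = 6"
    using indicial_solutions card by blast
  then show False
  proof cases
    \<comment> \<open>Octahedral case: \<open>A = - A\<close>, so \<open>a - 0 = 0 - (- a)\<close> is a repeated difference.\<close>
    case 1
    have "coeff ?f 0 = 0" using indicial[of 0] 1 by auto
    then have "0 \<in> A" using poly_vanishing_poly_eq_0_iff[OF fin, of 0] by (simp add: poly_0_coeff_0)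
    have "?f = monom 1 5 + monom (coeff ?f 1) 1"
    proof (rule poly_eqI)
      fix i :: nat
      consider "i = 0" | "i = 1" | "1 < i" "i < 5" | "i = 5" | "i > 5" by linarith
      then show "coeff ?f i = coeff (monom 1 5 + monom (coeff ?f 1) 1) i"
        by cases (use 1 \<open>coeff ?f 0 = 0\<close> gap lead deg in \<open>simp_all add: coeff_eq_0\<close>)
    qed
    then have eval: "poly ?f x = x ^ 5 + coeff ?f 1 * x" for x
      by (metis mult_1 poly_add poly_monom power_one_right)
    have "A \<noteq> {0}" using card by auto
    then obtain a where a: "a \<in> A" "a \<noteq> 0" using \<open>0 \<in> A\<close> by blast
    have "poly ?f (- a) = - poly ?f a" unfolding eval by simp
    then have "- a \<in> A" using a(1) by (simp flip: poly_vanishing_poly_eq_0_iff[OF fin])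
    then have "a = 0" using inj[of a 0 0 "- a"] a \<open>0 \<in> A\<close> by simp
    then show False using a by simp
  next
    \<comment> \<open>Icosahedral case, excluded by the fifth order condition at the root \<open>0\<close>.\<close>
    case 2
    have low: "coeff ?f i = 0" if "1 < i" "i < 6" for i
      using indicial[of i] that 2 by fastforce
    define b c e where "b = coeff ?f 0" and "c = coeff ?f 1" and "e = coeff ?f 6"
    have f: "?f = [:b, c, 0, 0, 0, 0, e, 0, 0, 0, 0, 1:]"
    proof (rule poly_eqI)
      fix i :: nat
      consider "i = 0" | "i = 1" | "1 < i" "i < 6" | "i = 6" | "6 < i" "i < 11" | "i = 11" | "i > 11"
        by linarith
      then show "coeff ?f i = coeff [:b, c, 0, 0, 0, 0, e, 0, 0, 0, 0, 1:] i"
      proof cases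
        case 3
        then have "i \<in> {2, 3, 4, 5}" by auto
        then show ?thesis using low 3 by (auto simp: coeff_pCons eval_nat_numeral)
      next
        case 5
        then have "i \<in> {7, 8, 9, 10}" by auto
        then show ?thesis using gap 5 2 by (auto simp: coeff_pCons eval_nat_numeral)
      next
        case 7
        then show ?thesis using deg 2 by (auto simp: coeff_eq_0)
      qed (use lead 2 in \<open>auto simp: b_def c_def e_def eval_nat_numeral\<close>)
    qed
    \<comment> \<open>Only \<open>x^11\<close> paired with the constant term \<open>b\<close>
      reaches degree \<open>7 = 11 - 4\<close>, contributing
      \<open>11 * 12 * (11 * 10 * 9 * 8) * b\<close>.\<close>
    have "coeff (fourth_transvectant 11 ?f) 7 = 0" using L 2 by simp
    then have "1045440 * b = 0"
      unfolding fourth_transvectant_def f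
      by (simp add: eval_nat_numeral pderiv_pCons)
    moreover have "(1045440 :: 'a) = 11 * (12 * (11 * (10 * (9 * 8))))" by simp
    ultimately have "11 * (12 * (11 * (10 * (9 * 8)))) * b = 0" by (simp only:)
    moreover have "220 < CHAR('a)" using char d 2 by simp
    ultimately have "b = 0" by (simp only: mult_eq_0_iff) (simp add: numeral_nonzero_less_CHAR)
    then have "0 \<in> A"
      using poly_vanishing_poly_eq_0_iff[OF fin, of 0] by (simp add: poly_0_coeff_0 b_def)
    then have G: "coeff (vanishing_poly (A - {0})) i = coeff ?f (Suc i)" for i
      using vanishing_poly_remove[OF fin, of 0] by simp
    \<comment> \<open>Here \<open>f / x = x^10 + e x^5 + c\<close>, so this says
      \<open>e = 0\<close>, against the choice of \<open>j = 6\<close>.\<close>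
    have "coeff (vanishing_poly (A - {0})) 5 = 0"
    proof (rule local_fifth_order[OF fin \<open>0 \<in> A\<close>])
      show "card A = 11" "220 < CHAR('a)" using card 2 char d by simp_all
      show "(x - y) ^ 110 = 1" if "x \<in> A" "y \<in> A" "x \<noteq> y" for x y
        using roots[OF that] d 2 by simp
      show "coeff (vanishing_poly (A - {0})) k = 0" if "0 < k" "k < 5" for k
        using low that by (simp add: G)
    qed
    then show False using fj 2 by (simp add: G)
  qed
qed

text \<open>Subtracting the mean, which exists because \<open>n\<close> is invertible, makes the sum
  zero and preserves all differences.\<close>

lemma no_large_set:
  fixes A :: "'a::field set"
  assumes fin: "finite A" and card: "card A = n" "n \<ge> 4"
    and d: "d = n * (n - 1)"
    and char: "2 * d < CHAR('a)"
    and roots: "\<And>x y. x \<in> A \<Longrightarrow> y \<in> A \<Longrightarrow> x \<noteq> y \<Longrightarrow> (x - y) ^ d = 1"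
    and inj: "\<And>x y u v. \<lbrakk>x \<in> A; y \<in> A; u \<in> A; v \<in> A; x \<noteq> y; x - y = u - v\<rbrakk> \<Longrightarrow> x = u"
  shows False
proof -
  define c where "c = \<Sum>A / of_nat n"
  have "n * 1 \<le> n * (n - 1)" using card by (intro mult_le_mono) auto
  then have "n < CHAR('a)" using char d by linarith
  then have "(of_nat n :: 'a) \<noteq> 0"
    using card by (intro of_nat_nonzero_less_CHAR) auto
  then have c: "of_nat n * c = \<Sum>A" by (simp add: c_def)
  have injc: "inj_on (\<lambda>x. x - c) A" by (simp add: inj_on_def)
  show False
  proof (rule no_large_centred_set[OF _ _ card(2) d char])
    show "finite ((\<lambda>x. x - c) ` A)" using fin by simp
    show "card ((\<lambda>x. x - c) ` A) = n" using card injc by (simp add: card_image)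
    show "\<Sum>((\<lambda>x. x - c) ` A) = 0"
      using c card by (simp add: sum.reindex[OF injc] sum_subtractf)
    show "(x - y) ^ d = 1" if "x \<in> (\<lambda>x. x - c) ` A" "y \<in> (\<lambda>x. x - c) ` A" "x \<noteq> y" for x y
      using that roots by auto
    show "x = u" if A': "x \<in> (\<lambda>x. x - c) ` A" "y \<in> (\<lambda>x. x - c) ` A" "u \<in> (\<lambda>x. x - c) ` A"
      "v \<in> (\<lambda>x. x - c) ` A" "x \<noteq> y" "x - y = u - v" for x y u v
    proof -
      obtain x' y' u' v' where "x = x' - c" "y = y' - c" "u = u' - c" "v = v' - c"
        and "x' \<in> A" "y' \<in> A" "u' \<in> A" "v' \<in> A" using A'(1-4) by auto
      then show ?thesis using inj[of x' y' u' v'] A'(5,6) by simp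
    qed
  qed
qed

section \<open>Counting roots of unity and differences\<close>

lemma card_unity_roots_le:
  assumes "0 < d"
  shows "card (unity_roots d :: 'p::prime_card mod_ring set) \<le> d"
proof -
  let ?P = "monom 1 d - 1 :: 'p mod_ring poly"
  have "coeff ?P d = 1" using assms by simp
  then have nz: "?P \<noteq> 0" by (metis coeff_0 zero_neq_one)
  have "card {x. poly ?P x = 0} \<le> degree ?P" by (rule card_poly_roots_bound[OF nz])
  also have "degree ?P \<le> d" by (intro degree_diff_le degree_monom_le) simp
  finally show ?thesis by (simp add: unity_roots_def poly_monom)
qed

text \<open>With \<open>p - 1 = d e\<close>, the factorisation of \<open>(x^d)^e - 1\<close> covers
  the \<open>d e\<close> nonzero residues by the \<open>d\<close>-th roots of unity and at most
  \<open>d (e - 1)\<close> roots of the cofactor.\<close>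

lemma card_unity_roots:
  assumes "d dvd CARD('p::prime_card) - 1"
  shows "card (unity_roots d :: 'p mod_ring set) = d"
proof -
  let ?p = "CARD('p)"
  have p: "1 < ?p" using prime_card[where ?'a = 'p] prime_gt_1_nat by blast
  obtain e where e: "?p - 1 = d * e" using assms ..
  have de: "0 < d" "0 < e" using e p by (auto intro!: Nat.gr0I)
  let ?R = "{y :: 'p mod_ring. poly (\<Sum>i<e. monom 1 (d * i)) y = 0}"
  have "coeff (\<Sum>i<e. monom (1 :: 'p mod_ring) (d * i)) 0 = 1"
    using de by (simp add: coeff_sum)
  then have nz: "(\<Sum>i<e. monom (1 :: 'p mod_ring) (d * i)) \<noteq> 0" by auto
  have "degree (\<Sum>i<e. monom (1 :: 'p mod_ring) (d * i)) \<le> d * (e - 1)"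
    by (rule degree_sum_le) (auto intro!: order_trans[OF degree_monom_le] mult_le_mono)
  then have R: "card ?R \<le> d * (e - 1)" using card_poly_roots_bound[OF nz] by linarith
  have sub: "UNIV - {0} \<subseteq> unity_roots d \<union> ?R"
  proof
    fix x :: "'p mod_ring" assume x: "x \<in> UNIV - {0}"
    \<comment> \<open>Inverses are defined as powers with exponent \<open>p - 2\<close>, so Fermat's
      little theorem follows.\<close>
    have "x * inverse x = x * x ^ (?p - 2)" using x by (simp add: inverse_mod_ring_def nat_diff_distrib)
    also have "\<dots> = x ^ (?p - 1)" using p by (simp flip: power_Suc add: Suc_diff_Suc numeral_2_eq_2)
    finally have "x ^ (?p - 1) = 1" using x by simp
    then have "(x ^ d) ^ e = 1" unfolding e by (simp add: power_mult)
    then have "(x ^ d - 1) * (\<Sum>i<e. (x ^ d) ^ i) = 0"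
      by (simp flip: power_diff_1_eq)
    then show "x \<in> unity_roots d \<union> ?R"
      by (auto simp: unity_roots_def poly_sum poly_monom power_mult)
  qed
  have "?p - 1 = card (UNIV - {0 :: 'p mod_ring})" by (simp add: card_Diff_subset)
  also have "\<dots> \<le> card (unity_roots d \<union> ?R)" by (rule card_mono[OF _ sub]) simp
  also have "\<dots> \<le> card (unity_roots d :: 'p mod_ring set) + card ?R" by (rule card_Un_le)
  finally have "d * e \<le> card (unity_roots d :: 'p mod_ring set) + d * (e - 1)" using R e by linarith
  moreover have "d * e = d + d * (e - 1)" using de by (cases e) auto
  ultimately show ?thesis using card_unity_roots_le[OF de(1), where ?'p = 'p] by linarith
qed

theorem theorem1:
  fixes p d :: nat and A :: "'p::prime_card mod_ring set"
  assumes "p = CARD('p)"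
    and "d dvd p - 1" and "1 < d" and "d < p - 1"
    and "difference_set A = unity_roots d \<union> {0}"
  shows "d = 2 \<or> d = 6"
proof -
  let ?n = "card A" and ?U = "unity_roots d :: 'p mod_ring set"
  define D where "D = (\<lambda>(x, y). x - y :: 'p mod_ring)"
  define P where "P = A \<times> A - (\<lambda>x. (x, x)) ` A"
  have fin: "finite A" by simp
  have CHAR: "CHAR('p mod_ring) = p" using assms(1) by simp
  have card_U: "card ?U = d" using assms(1,2) by (intro card_unity_roots) simp
  obtain e where e: "p - 1 = d * e" using assms(2) ..
  have "e \<noteq> 0" "e \<noteq> 1" using e assms(4) by auto
  then have "d * 2 \<le> p - 1" unfolding e by (intro mult_le_mono) auto
  then have char: "2 * d < CHAR('p mod_ring)" using CHAR assms(3) by linarith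
  have roots: "(x - y) ^ d = 1" if "x \<in> A" "y \<in> A" "x \<noteq> y" for x y
  proof -
    have "x - y \<in> difference_set A" using that by (auto simp: difference_set_def)
    then show ?thesis using that assms(5) by (auto simp: unity_roots_def)
  qed
  have DP: "D ` P = ?U"
  proof
    show "D ` P \<subseteq> ?U" using roots by (auto simp: D_def P_def unity_roots_def)
    show "?U \<subseteq> D ` P"
    proof
      fix u assume u: "u \<in> ?U"
      then have "u \<noteq> 0" using assms(3) by (auto simp: unity_roots_def power_0_left)
      have "u \<in> difference_set A" using u assms(5) by simp
      then obtain x y where "x \<in> A" "y \<in> A" "u = x - y" by (auto simp: difference_set_def)
      with \<open>u \<noteq> 0\<close> have "(x, y) \<in> P" "u = D (x, y)" by (auto simp: P_def D_def)
      then show "u \<in> D ` P" by blast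
    qed
  qed
  have card_P: "card P = ?n * (?n - 1)"
  proof -
    have "card P = card (A \<times> A) - card ((\<lambda>x. (x, x)) ` A)"
      unfolding P_def by (rule card_Diff_subset) auto
    also have "\<dots> = ?n * ?n - ?n" by (simp add: card_cartesian_product card_image inj_on_def)
    finally show ?thesis by (simp add: diff_mult_distrib2)
  qed
  have upper: "d \<le> ?n * (?n - 1)"
    using card_image_le[of P D] DP card_U card_P by simp
  have n2: "?n \<ge> 2"
  proof (rule ccontr)
    assume "\<not> ?thesis"
    then have "?n = 0 \<or> ?n - 1 = 0" by linarith
    then have "?n * (?n - 1) = 0" by (simp only: mult_eq_0_iff)
    then show False using upper assms(3) by linarith
  qed
  \<comment> \<open>A crude bound from the differences \<open>x - a\<close> with \<open>a\<close>
    fixed; it supplies the characteristic condition of the Stepanov bound.\<close>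
  have "?n - 1 \<le> d"
  proof -
    obtain a where a: "a \<in> A" using n2 by fastforce
    have "?n - 1 = card ((\<lambda>x. x - a) ` (A - {a}))" using a by (simp add: card_image inj_on_def)
    also have "\<dots> \<le> card ?U" using roots a by (intro card_mono) (auto simp: unity_roots_def)
    finally show ?thesis using card_U by simp
  qed
  then have "d + (?n - 1) < CHAR('p mod_ring)" using char by linarith
  then have "?n * (?n - 1) \<le> d"
    using stepanov_card_bound[OF fin n2 _ _ roots] assms(3) by simp
  then have d: "d = ?n * (?n - 1)" using upper by simp
  \<comment> \<open>A surjection between finite sets of equal size is injective: no nonzero
    difference repeats.\<close>
  have "inj_on D P"
    by (rule eq_card_imp_inj_on) (use DP card_U card_P d in simp_all)
  have inj: "x = u" if "x \<in> A" "y \<in> A" "u \<in> A" "v \<in> A" "x \<noteq> y" "x - y = u - v" for x y u v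
  proof -
    have "(x, y) \<in> P" "(u, v) \<in> P" "D (x, y) = D (u, v)" using that by (auto simp: P_def D_def)
    then show ?thesis using \<open>inj_on D P\<close> by (auto dest: inj_onD)
  qed
  have "\<not> ?n \<ge> 4"
  proof
    assume "?n \<ge> 4"
    then show False by (rule no_large_set[OF fin refl _ d char]) (fact roots, fact inj)
  qed
  \<comment> \<open>These give \<open>d = 2\<close> and \<open>d = 6\<close>.\<close>
  then have "?n = 2 \<or> ?n = 3" using n2 by linarith
  then show ?thesis using d by auto
qed

end
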